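(* Let $P=\prod_{i=1}^m p_i$ be a product distribution with all $p_i(a)>0$ on the finite product set $K=\prod_{i=1}^m A_i$, $N=|K|$, with surprisal $S(x)=-\ln P(x)$. (i) For every $\rho>0$, among all guessing orders $G:K\to\{1,\dots,N\}$ (bijections), the moment $\mathbb{E}_P[G^\rho]=\sum_{x\in K}P(x)G(x)^\rho$ is minimized exactly by the likelihood-ordered ones, and its value is invariant under permutations of the order within equal-surprisal blocks $\{x: S(x)=t\}$. (ii) Every optimal (i.e. likelihood-ordered) $G$ satisfies, for every $x\in K$, $$N\,F_S(S(x)^-)<G(x)\le N\,F_S(S(x))=G^*(x);$$ that is, the ranks of the keys on level $t$ fill $J_t$. (iii) For every $\rho>0$ and every optimal $G$, $\mathbb{E}_P[G^\rho]=\sum_t \pi(t)\,\mathcal{A}_\rho(t)$, and therefore $f(\rho)=\ln\sum_t\pi(t)\,\mathcal{A}_\rho(t)$, where the sum runs over all values $t$ taken by $S$.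
   Context: $A_1,\dots,A_m$ are finite nonempty sets, $K=\prod_i A_i$, $N=|K|$; each $p_i$ is a probability distribution on $A_i$ with $p_i(a)>0$ for all $a$; $P(x)=\prod_i p_i(x_i)$; $U$ is the uniform distribution on $K$. Surprisal: $S(x)=-\ln P(x)$. A guessing order is a bijection $G:K\to\{1,\dots,N\}$. It is likelihood-ordered if $P(x)>P(y)$ implies $G(x)<G(y)$ (keys enumerated by increasing surprisal, ties in any order). $f(\rho)=\ln\mathbb{E}_P[G^\rho]$ for an optimal $G$. The block-maximal rank is $G^*(x)=\#\{x'\in K:S(x')\le S(x)\}$. For real $t$: $F_S(t)=\mathbb{P}_U[S\le t]$, $F_S(t^-)=\mathbb{P}_U[S<t]$, $\nu(t)=\mathbb{P}_U[S=t]$, $n(t)=N\nu(t)$, $\pi(t)=\mathbb{P}_P[S=t]$. For a value $t$ taken by $S$, $$J_t=\{N F_S(t^-)+1,\dots,N F_S(t)\},\qquad \mathcal{A}_\rho(t)=\frac1{n(t)}\sum_{r\in J_t}r^\rho .$$ *)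

theory Defs
  imports "HOL-Probability.Probability"
begin

text \<open>
  Everything below is stated for a finite key set \<open>K\<close> and a distribution \<open>P\<close> with support \<open>K\<close>.
  A guessing order is a total function of which only the values on \<open>K\<close> matter.
\<close>

definition surprisal :: "'k pmf \<Rightarrow> 'k \<Rightarrow> real" where
  "surprisal P x = - ln (pmf P x)"

definition guessing_order :: "'k set \<Rightarrow> ('k \<Rightarrow> nat) \<Rightarrow> bool" where
  "guessing_order K G \<longleftrightarrow> bij_betw G K {1..card K}"

definition likelihood_ordered :: "'k set \<Rightarrow> 'k pmf \<Rightarrow> ('k \<Rightarrow> nat) \<Rightarrow> bool" where
  "likelihood_ordered K P G \<longleftrightarrow> (\<forall>x\<in>K. \<forall>y\<in>K. pmf P x > pmf P y \<longrightarrow> G x < G y)"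

definition guess_moment :: "'k pmf \<Rightarrow> real \<Rightarrow> ('k \<Rightarrow> nat) \<Rightarrow> real" where
  "guess_moment P \<rho> G = measure_pmf.expectation P (\<lambda>x. real (G x) powr \<rho>)"

definition optimal_order :: "'k set \<Rightarrow> 'k pmf \<Rightarrow> real \<Rightarrow> ('k \<Rightarrow> nat) \<Rightarrow> bool" where
  "optimal_order K P \<rho> G \<longleftrightarrow> is_arg_min (guess_moment P \<rho>) (guessing_order K) G"

text \<open>The function \<open>f(\<rho>)\<close>: the logarithmic moment of an (arbitrarily chosen) optimal order.\<close>

definition log_guess_moment :: "'k set \<Rightarrow> 'k pmf \<Rightarrow> real \<Rightarrow> real" where
  "log_guess_moment K P \<rho> = ln (guess_moment P \<rho> (SOME G. optimal_order K P \<rho> G))"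

definition block_max_rank :: "'k set \<Rightarrow> 'k pmf \<Rightarrow> 'k \<Rightarrow> nat" where
  "block_max_rank K P x = card {x' \<in> K. surprisal P x' \<le> surprisal P x}"

text \<open>
  \<open>F\<^sub>S(t)\<close>, \<open>F\<^sub>S(t\<^sup>-)\<close> and \<open>\<nu>(t)\<close> refer to the uniform distribution on \<open>K\<close>, whereas
  \<open>\<pi>(t)\<close> refers to \<open>P\<close>.
\<close>

definition surprisal_cdf :: "'k set \<Rightarrow> 'k pmf \<Rightarrow> real \<Rightarrow> real" where
  "surprisal_cdf K P t = measure_pmf.prob (pmf_of_set K) {x. surprisal P x \<le> t}"

definition surprisal_cdf_left :: "'k set \<Rightarrow> 'k pmf \<Rightarrow> real \<Rightarrow> real" where
  "surprisal_cdf_left K P t = measure_pmf.prob (pmf_of_set K) {x. surprisal P x < t}"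

definition level_fraction :: "'k set \<Rightarrow> 'k pmf \<Rightarrow> real \<Rightarrow> real" where
  "level_fraction K P t = measure_pmf.prob (pmf_of_set K) {x. surprisal P x = t}"

definition level_count :: "'k set \<Rightarrow> 'k pmf \<Rightarrow> real \<Rightarrow> real" where
  "level_count K P t = real (card K) * level_fraction K P t"

definition level_prob :: "'k pmf \<Rightarrow> real \<Rightarrow> real" where
  "level_prob P t = measure_pmf.prob P {x. surprisal P x = t}"

text \<open>
  The interval \<open>J\<^sub>t\<close> of ranks; its end points are reals that happen to be integers, so it is
  written as the set of naturals between them.
\<close>

definition level_ranks :: "'k set \<Rightarrow> 'k pmf \<Rightarrow> real \<Rightarrow> nat set" where
  "level_ranks K P t =
     {r. real (card K) * surprisal_cdf_left K P t + 1 \<le> real r \<and>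
         real r \<le> real (card K) * surprisal_cdf K P t}"

definition level_average :: "'k set \<Rightarrow> 'k pmf \<Rightarrow> real \<Rightarrow> real \<Rightarrow> real" where
  "level_average K P \<rho> t =
     1 / level_count K P t * (\<Sum>r\<in>level_ranks K P t. real r powr \<rho>)"

end

theory Submission
  imports Defs
begin

text \<open>
  Swapping an inverted pair of ranks strictly lowers the moment, so every minimizer is
  likelihood-ordered. In a likelihood-ordered enumeration the ranks of a surprisal level are forced
  to be the interval following all less surprising keys, so all such enumerations have the same
  moment; since a minimizer exists, all of them are minimizers.
\<close>

text \<open>Setting of the argument: a finite key set that is exactly the support, so that surprisal
  and probability determine each other on it. The product distribution will be an instance.\<close>

locale finite_support_pmf =
  fixes K :: "'k set" and P :: "'k pmf"
  assumes finite_K: "finite K" and set_P: "set_pmf P = K"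
begin

abbreviation level :: "real \<Rightarrow> 'k set" where
  "level t \<equiv> {x \<in> K. surprisal P x = t}"

lemma K_nonempty: "K \<noteq> {}"
  using set_P set_pmf_not_empty[of P] by simp

lemma pmf_pos: "x \<in> K \<Longrightarrow> pmf P x > 0"
  using set_P pmf_positive[of x P] by simp

lemma pmf_eq_exp: "x \<in> K \<Longrightarrow> pmf P x = exp (- surprisal P x)"
  by (simp add: surprisal_def pmf_pos)

lemma surprisal_less_iff:
  "x \<in> K \<Longrightarrow> y \<in> K \<Longrightarrow> surprisal P x < surprisal P y \<longleftrightarrow> pmf P y < pmf P x"
  by (simp add: pmf_eq_exp)

section \<open>Moments and exchange of ranks\<close>

lemma guess_moment_sum: "guess_moment P \<rho> G = (\<Sum>x\<in>K. pmf P x * real (G x) powr \<rho>)"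
  unfolding guess_moment_def
  by (subst integral_measure_pmf_real[OF finite_K]) (auto simp: set_P mult.commute)

lemma guessing_order_comp:
  assumes "guessing_order K G" "\<sigma> permutes K"
  shows "guessing_order K (G \<circ> \<sigma>)"
  using assms unfolding guessing_order_def by (metis bij_betw_trans permutes_imp_bij)

text \<open>Such a permutation also preserves \<open>pmf P\<close> on \<open>K\<close>, so the sum
  is merely reindexed.\<close>

lemma guess_moment_comp:
  assumes \<sigma>: "\<sigma> permutes K" and lev: "\<forall>x\<in>K. surprisal P (\<sigma> x) = surprisal P x"
  shows "guess_moment P \<rho> (G \<circ> \<sigma>) = guess_moment P \<rho> G"
proof -
  have "guess_moment P \<rho> (G \<circ> \<sigma>) = (\<Sum>x\<in>K. pmf P (\<sigma> x) * real (G (\<sigma> x)) powr \<rho>)"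
    unfolding guess_moment_sum
    using lev permutes_in_image[OF \<sigma>] by (intro sum.cong) (simp_all add: pmf_eq_exp)
  also have "\<dots> = guess_moment P \<rho> G"
    unfolding guess_moment_sum using sum.permute[OF \<sigma>, of "\<lambda>x. pmf P x * real (G x) powr \<rho>"]
    by (simp add: comp_def)
  finally show ?thesis .
qed

lemma guess_moment_transpose_less:
  assumes "\<rho> > 0" "x \<in> K" "y \<in> K" "pmf P y < pmf P x" "G y < G x"
  shows "guess_moment P \<rho> (G \<circ> Transposition.transpose x y) < guess_moment P \<rho> G"
proof -
  have xy: "x \<noteq> y" using assms by auto
  define R where "R = K - {x, y}"
  have K: "K = insert x (insert y R)" and R: "finite R" "x \<notin> R" "y \<notin> R"
    using assms finite_K by (auto simp: R_def)
  have rest: "(\<Sum>z\<in>R. pmf P z * real ((G \<circ> Transposition.transpose x y) z) powr \<rho>) =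
      (\<Sum>z\<in>R. pmf P z * real (G z) powr \<rho>)"
    using R by (intro sum.cong) (auto simp: Transposition.transpose_def)
  have "real (G y) powr \<rho> < real (G x) powr \<rho>"
    using assms by (intro powr_less_mono2) auto
  \<comment> \<open>This product is exactly the drop in the moment caused by the swap; all summands
    over \<open>R\<close> are unchanged.\<close>
  hence "0 < (pmf P x - pmf P y) * (real (G x) powr \<rho> - real (G y) powr \<rho>)"
    using assms by simp
  hence "pmf P x * real (G y) powr \<rho> + pmf P y * real (G x) powr \<rho> <
      pmf P x * real (G x) powr \<rho> + pmf P y * real (G y) powr \<rho>"
    by (simp add: algebra_simps)
  thus ?thesis
    unfolding guess_moment_sum K using R xy rest by simp
qed

lemma optimal_imp_likelihood_ordered:
  assumes "\<rho> > 0" and opt: "optimal_order K P \<rho> G"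
  shows "likelihood_ordered K P G"
  unfolding likelihood_ordered_def
proof (intro ballI impI)
  fix x y assume xy: "x \<in> K" "y \<in> K" "pmf P y < pmf P x"
  have G: "guessing_order K G"
    using opt by (simp add: optimal_order_def is_arg_min_def)
  \<comment> \<open>The strict gap in probability forces \<open>x \<noteq> y\<close>, so injectivity
    excludes equal ranks.\<close>
  have "G x \<noteq> G y"
    using G xy unfolding guessing_order_def bij_betw_def inj_on_def by auto
  moreover have "\<not> G y < G x"
  proof
    assume "G y < G x"
    with assms xy have "guess_moment P \<rho> (G \<circ> Transposition.transpose x y) < guess_moment P \<rho> G"
      by (intro guess_moment_transpose_less)
    moreover have "guessing_order K (G \<circ> Transposition.transpose x y)"
      using G xy by (intro guessing_order_comp permutes_swap_id)
    ultimately show False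
      using opt by (auto simp: optimal_order_def is_arg_min_def)
  qed
  ultimately show "G x < G y" by simp
qed

text \<open>
  There are infinitely many guessing orders, as values outside \<open>K\<close> are unconstrained; restricting
  to extensional ones leaves finitely many candidates.
\<close>

lemma ex_optimal_order: "\<exists>G. optimal_order K P \<rho> G"
proof -
  define \<G> where "\<G> = {G \<in> K \<rightarrow>\<^sub>E {1..card K}. guessing_order K G}"
  have restrict: "restrict G K \<in> \<G>" if "guessing_order K G" for G
    using that by (auto simp: \<G>_def guessing_order_def bij_betw_def inj_on_def)
  obtain h where "bij_betw h K {0..<card K}"
    using ex_bij_betw_finite_nat[OF finite_K] by blast
  \<comment> \<open>Ranks start at 1, hence the shift by \<open>Suc\<close>.\<close>
  hence "bij_betw (Suc \<circ> h) K {1..card K}"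
    by (rule bij_betw_trans) (auto simp: bij_betw_def image_Suc_atLeastLessThan atLeastLessThanSuc_atLeastAtMost)
  hence "\<G> \<noteq> {}"
    using restrict unfolding guessing_order_def by blast
  moreover have "finite \<G>"
    unfolding \<G>_def
    by (rule finite_subset[of _ "K \<rightarrow>\<^sub>E {1..card K}"]) (auto intro: finite_PiE finite_K)
  ultimately obtain G where G: "is_arg_min (guess_moment P \<rho>) (\<lambda>G. G \<in> \<G>) G"
    using ex_is_arg_min_if_finite by blast
  \<comment> \<open>The moment sees only values on \<open>K\<close>, so minimality among extensional
    orders extends to all guessing orders.\<close>
  have "guess_moment P \<rho> (restrict H K) = guess_moment P \<rho> H" for H
    unfolding guess_moment_sum by (intro sum.cong) auto
  hence "\<not> guess_moment P \<rho> H < guess_moment P \<rho> G" if "guessing_order K H" for H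
    using G restrict[OF that] by (metis is_arg_min_def)
  moreover have "guessing_order K G"
    using G by (simp add: is_arg_min_def \<G>_def)
  ultimately show ?thesis
    unfolding optimal_order_def is_arg_min_def by blast
qed

section \<open>Levels and their rank intervals\<close>

lemma card_mult_prob: "real (card K) * measure_pmf.prob (pmf_of_set K) A = real (card (K \<inter> A))"
  using finite_K K_nonempty by (simp add: measure_pmf_of_set)

lemma surprisal_cdf_card:
  "real (card K) * surprisal_cdf K P t = real (card {x \<in> K. surprisal P x \<le> t})"
  unfolding surprisal_cdf_def card_mult_prob by (simp add: Int_def)

lemma surprisal_cdf_left_card:
  "real (card K) * surprisal_cdf_left K P t = real (card {x \<in> K. surprisal P x < t})"
  unfolding surprisal_cdf_left_def card_mult_prob by (simp add: Int_def)

lemma level_count_card: "level_count K P t = real (card (level t))"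
  unfolding level_count_def level_fraction_def card_mult_prob by (simp add: Int_def)

text \<open>Scaled by \<open>card K\<close>, the uniform probabilities are cardinalities; for
  naturals the \<open>+ 1\<close> at the lower end means a strict inequality, hence the half-open
  interval.\<close>

lemma level_ranks_eq:
  "level_ranks K P t = {card {x \<in> K. surprisal P x < t} <.. card {x \<in> K. surprisal P x \<le> t}}"
  unfolding level_ranks_def surprisal_cdf_card surprisal_cdf_left_card by auto

lemma card_le_eq_less_plus_level:
  "card {x \<in> K. surprisal P x \<le> t} = card {x \<in> K. surprisal P x < t} + card (level t)"
proof -
  have "{x \<in> K. surprisal P x \<le> t} = {x \<in> K. surprisal P x < t} \<union> level t" by auto
  thus ?thesis
    using finite_K by (simp add: card_Un_disjoint disjoint_iff)
qed

text \<open>All less surprising keys come before \<open>x\<close>, which bounds its rank from below;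
  every rank up to \<open>G x\<close> belongs to a key that is no more surprising, which bounds it
  from above.\<close>

lemma likelihood_ordered_rank:
  assumes G: "guessing_order K G" and lik: "likelihood_ordered K P G" and x: "x \<in> K"
  shows "G x \<in> level_ranks K P (surprisal P x)"
proof -
  let ?L = "{y \<in> K. surprisal P y < surprisal P x}"
  let ?M = "{y \<in> K. surprisal P y \<le> surprisal P x}"
  have inj: "inj_on G K" and img: "G ` K = {1..card K}"
    using G by (auto simp: guessing_order_def bij_betw_def)
  have Gx: "1 \<le> G x" "G x \<le> card K"
    using img x by fastforce+
  have "G ` ?L \<subseteq> {1..<G x}"
    using img lik x by (fastforce simp: likelihood_ordered_def surprisal_less_iff)
  \<comment> \<open>The right side is \<open>G x - 1\<close>; with \<open>1 \<le> G x\<close> the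
    lower bound becomes strict.\<close>
  hence "card (G ` ?L) \<le> card {1..<G x}"
    by (intro card_mono) auto
  moreover have "card (G ` ?L) = card ?L"
    by (intro card_image inj_on_subset[OF inj]) auto
  \<comment> \<open>Surjectivity provides a key for each rank \<open>r\<close>; were it more
    surprising than \<open>x\<close>, it would be ranked after \<open>x\<close>.\<close>
  moreover have "{1..G x} \<subseteq> G ` ?M"
  proof
    fix r assume r: "r \<in> {1..G x}"
    then have "r \<in> G ` K" using Gx img by auto
    then obtain y where y: "y \<in> K" "r = G y" by auto
    hence "\<not> surprisal P x < surprisal P y"
      using r lik x by (auto simp: likelihood_ordered_def surprisal_less_iff not_less[symmetric])
    thus "r \<in> G ` ?M" using y by auto
  qed
  hence "card {1..G x} \<le> card (G ` ?M)"
    using finite_K by (intro card_mono) auto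
  hence "G x \<le> card ?M"
    using card_image_le[of ?M G] finite_K by simp
  ultimately show ?thesis
    using Gx unfolding level_ranks_eq by auto
qed

text \<open>The rank bounds give one inclusion; since \<open>G\<close> is injective and the interval
  has as many elements as the level, it is an equality.\<close>

lemma likelihood_ordered_image_level:
  assumes "guessing_order K G" "likelihood_ordered K P G"
  shows "G ` level t = level_ranks K P t"
proof (rule card_subset_eq)
  show "finite (level_ranks K P t)" by (simp add: level_ranks_eq)
  show "G ` level t \<subseteq> level_ranks K P t"
    using likelihood_ordered_rank[OF assms] by auto
  have "inj_on G (level t)"
    using assms(1) by (auto simp: guessing_order_def bij_betw_def inj_on_def)
  thus "card (G ` level t) = card (level_ranks K P t)"
    by (simp add: card_image level_ranks_eq card_le_eq_less_plus_level)
qed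

section \<open>The moment summed by levels\<close>

lemma level_prob_eq: "level_prob P t = real (card (level t)) * exp (- t)"
proof -
  have "level_prob P t = measure_pmf.prob P (level t)"
    \<comment> \<open>\<open>level_prob\<close> measures a set in the whole type, which may contain
      points outside \<open>K\<close>; these have probability zero.\<close>
    unfolding level_prob_def by (rule measure_prob_cong_0) (use set_P in \<open>auto simp: set_pmf_iff\<close>)
  also have "\<dots> = (\<Sum>x\<in>level t. pmf P x)"
    using finite_K by (simp add: measure_measure_pmf_finite)
  also have "\<dots> = (\<Sum>x\<in>level t. exp (- t))"
    by (intro sum.cong) (auto simp: pmf_eq_exp)
  finally show ?thesis by simp
qed

text \<open>Within a level the weight is the constant \<open>exp (- t)\<close> and the ranks form a
  fixed interval, so grouping by levels removes all dependence on \<open>G\<close>.\<close>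

lemma likelihood_ordered_guess_moment:
  assumes G: "guessing_order K G" and lik: "likelihood_ordered K P G"
  shows "guess_moment P \<rho> G =
    (\<Sum>t\<in>surprisal P ` K. level_prob P t * level_average K P \<rho> t)"
proof -
  have "guess_moment P \<rho> G =
      (\<Sum>t\<in>surprisal P ` K. \<Sum>x\<in>level t. pmf P x * real (G x) powr \<rho>)"
    unfolding guess_moment_sum using finite_K by (rule sum.image_gen)
  also have "\<dots> = (\<Sum>t\<in>surprisal P ` K. level_prob P t * level_average K P \<rho> t)"
  proof (intro sum.cong refl)
    fix t assume "t \<in> surprisal P ` K"
    \<comment> \<open>Needed to cancel the level size in \<open>level_prob\<close> against the
      denominator of \<open>level_average\<close>.\<close>
    hence ne: "card (level t) \<noteq> 0" using finite_K by auto
    have inj: "inj_on G (level t)"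
      using G by (auto simp: guessing_order_def bij_betw_def inj_on_def)
    have "(\<Sum>x\<in>level t. pmf P x * real (G x) powr \<rho>) =
        (\<Sum>x\<in>level t. exp (- t) * real (G x) powr \<rho>)"
      by (intro sum.cong) (auto simp: pmf_eq_exp)
    also have "\<dots> = exp (- t) * (\<Sum>r\<in>level_ranks K P t. real r powr \<rho>)"
      by (simp add: sum_distrib_left sum.reindex[OF inj]
          flip: likelihood_ordered_image_level[OF assms])
    also have "\<dots> = level_prob P t * level_average K P \<rho> t"
      using ne by (simp add: level_prob_eq level_average_def level_count_card)
    finally show "(\<Sum>x\<in>level t. pmf P x * real (G x) powr \<rho>) =
        level_prob P t * level_average K P \<rho> t" .
  qed
  finally show ?thesis .
qed

lemma optimal_order_guess_moment:
  assumes "\<rho> > 0" "optimal_order K P \<rho> G"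
  shows "guess_moment P \<rho> G =
    (\<Sum>t\<in>surprisal P ` K. level_prob P t * level_average K P \<rho> t)"
proof (rule likelihood_ordered_guess_moment)
  show "guessing_order K G"
    using assms by (simp add: optimal_order_def is_arg_min_def)
  show "likelihood_ordered K P G"
    using assms by (rule optimal_imp_likelihood_ordered)
qed

lemma optimal_order_iff:
  assumes "\<rho> > 0" "guessing_order K G"
  shows "optimal_order K P \<rho> G \<longleftrightarrow> likelihood_ordered K P G"
proof
  assume "likelihood_ordered K P G"
  obtain H where H: "optimal_order K P \<rho> H"
    using ex_optimal_order by blast
  have "guess_moment P \<rho> G = guess_moment P \<rho> H"
    using likelihood_ordered_guess_moment[OF assms(2) \<open>likelihood_ordered K P G\<close>]
      optimal_order_guess_moment[OF assms(1) H] by simp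
  thus "optimal_order K P \<rho> G"
    using H assms by (simp add: optimal_order_def is_arg_min_def)
qed (use assms optimal_imp_likelihood_ordered in blast)

lemma log_guess_moment_eq:
  assumes "\<rho> > 0"
  shows "log_guess_moment K P \<rho> =
    ln (\<Sum>t\<in>surprisal P ` K. level_prob P t * level_average K P \<rho> t)"
  unfolding log_guess_moment_def
  \<comment> \<open>A minimizer exists, so \<open>SOME\<close> yields one, and all minimizers share
    this value.\<close>
  using optimal_order_guess_moment[OF assms someI_ex[OF ex_optimal_order]] by simp

end

section \<open>Application to product distributions\<close>

lemma set_Pi_pmf_undefined:
  assumes "finite I"
  shows "set_pmf (Pi_pmf I undefined p) = PiE I (\<lambda>i. set_pmf (p i))"
  \<comment> \<open>The default \<open>undefined\<close> is the value that extensional functions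
    take outside \<open>I\<close>, so the dependent product with default is
    \<open>PiE\<close>.\<close>
  using assms by (auto simp: set_Pi_pmf PiE_dflt_def PiE_def Pi_def extensional_def)

theorem lemma3p1:
  fixes m :: nat
    and A :: "nat \<Rightarrow> 'a set"
    and p :: "nat \<Rightarrow> 'a pmf"
    and K :: "(nat \<Rightarrow> 'a) set"
    and P :: "(nat \<Rightarrow> 'a) pmf"
  assumes A_finite: "\<And>i. i \<in> {1..m} \<Longrightarrow> finite (A i)"
    and A_nonempty: "\<And>i. i \<in> {1..m} \<Longrightarrow> A i \<noteq> {}"
    and p_support: "\<And>i. i \<in> {1..m} \<Longrightarrow> set_pmf (p i) = A i"
    and K_def: "K = PiE {1..m} A"
    and P_def: "P = Pi_pmf {1..m} undefined p"
  shows
    "(\<forall>\<rho>>0. \<forall>G. guessing_order K G \<longrightarrow>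
        guess_moment P \<rho> G = (\<Sum>x\<in>K. (\<Prod>i=1..m. pmf (p i) (x i)) * real (G x) powr \<rho>) \<and>
        (optimal_order K P \<rho> G \<longleftrightarrow> likelihood_ordered K P G) \<and>
        (\<forall>\<sigma>. \<sigma> permutes K \<and> (\<forall>x\<in>K. surprisal P (\<sigma> x) = surprisal P x) \<longrightarrow>
           guess_moment P \<rho> (G \<circ> \<sigma>) = guess_moment P \<rho> G)) \<and>
     (\<forall>G. guessing_order K G \<and> likelihood_ordered K P G \<longrightarrow>
        (\<forall>x\<in>K. real (card K) * surprisal_cdf_left K P (surprisal P x) < real (G x) \<and>
               real (G x) \<le> real (card K) * surprisal_cdf K P (surprisal P x) \<and>
               real (card K) * surprisal_cdf K P (surprisal P x) = real (block_max_rank K P x)) \<and>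
        (\<forall>t\<in>surprisal P ` K. G ` {x \<in> K. surprisal P x = t} = level_ranks K P t)) \<and>
     (\<forall>\<rho>>0.
        (\<forall>G. optimal_order K P \<rho> G \<longrightarrow>
           guess_moment P \<rho> G =
             (\<Sum>t\<in>surprisal P ` K. level_prob P t * level_average K P \<rho> t)) \<and>
        log_guess_moment K P \<rho> =
          ln (\<Sum>t\<in>surprisal P ` K. level_prob P t * level_average K P \<rho> t))"
proof -
  have support: "PiE {1..m} (\<lambda>i. set_pmf (p i)) = K"
    unfolding K_def using p_support by (intro PiE_cong) auto
  interpret finite_support_pmf K P
  proof
    show "finite K" unfolding K_def using A_finite by (intro finite_PiE) auto
    show "set_pmf P = K" unfolding P_def using support by (simp add: set_Pi_pmf_undefined)
  qed
  \<comment> \<open>Keys in \<open>K\<close> are extensional, so they agree with the default outside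
    \<open>{1..m}\<close> and the product formula applies.\<close>
  have "pmf P x = (\<Prod>i=1..m. pmf (p i) (x i))" if "x \<in> K" for x
    unfolding P_def using that by (subst pmf_Pi') (auto simp: K_def PiE_def extensional_def)
  hence "guess_moment P \<rho> G = (\<Sum>x\<in>K. (\<Prod>i=1..m. pmf (p i) (x i)) * real (G x) powr \<rho>)" for \<rho> G
    unfolding guess_moment_sum by (intro sum.cong) auto
  moreover have
    "real (card K) * surprisal_cdf_left K P (surprisal P x) < real (G x) \<and>
     real (G x) \<le> real (card K) * surprisal_cdf K P (surprisal P x) \<and>
     real (card K) * surprisal_cdf K P (surprisal P x) = real (block_max_rank K P x)"
    if "guessing_order K G" "likelihood_ordered K P G" "x \<in> K" for G x
    using likelihood_ordered_rank[OF that]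
    by (auto simp: level_ranks_def surprisal_cdf_card block_max_rank_def)
  ultimately show ?thesis
    using optimal_order_iff guess_moment_comp likelihood_ordered_image_level
      optimal_order_guess_moment log_guess_moment_eq
    by blast
qed

end
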